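(* Every J-adequate ring is J-stable.
   Context: All rings are commutative with identity. $J(R)$ denotes the Jacobson radical of $R$. A ring is a Bézout ring if every finitely generated ideal is principal. An element $a\in R$ is adequate if for every $b\in R$ there exist $r,s\in R$ such that (1) $a=rs$; (2) $rR+bR=R$; (3) $s'R+bR\neq R$ for each non-invertible divisor $s'$ of $s$. A J-adequate ring is a Bézout ring $R$ in which every element not in $J(R)$ is adequate. A ring $R$ has stable range $1$ if whenever $aR+bR=R$ with $a,b\in R$, there is $y\in R$ such that $a+by$ is invertible. A ring $R$ is J-stable if $R/aR$ has stable range $1$ for all $a\in R$ with $a\notin J(R)$. *)

theory Defs
  imports "HOL-Algebra.QuotRing" "HOL-Algebra.Divisibility"
begin

text \<open>
  Rings are commutative with identity (\<^locale>\<open>cring\<close>); the zero ring is not excluded.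
\<close>

text \<open>
  The intersection with the carrier only matters for the zero ring, which has no maximal ideals.
\<close>

definition jacobson_radical :: "('a, 'b) ring_scheme \<Rightarrow> 'a set" where
  "jacobson_radical R = carrier R \<inter> \<Inter>{M. maximalideal M R}"

definition bezout_ring :: "('a, 'b) ring_scheme \<Rightarrow> bool" where
  "bezout_ring R \<longleftrightarrow> cring R \<and>
     (\<forall>S. finite S \<and> S \<subseteq> carrier R \<longrightarrow> principalideal (Idl\<^bsub>R\<^esub> S) R)"

definition adequate :: "('a, 'b) ring_scheme \<Rightarrow> 'a \<Rightarrow> bool" where
  "adequate R a \<longleftrightarrow> a \<in> carrier R \<and>
     (\<forall>b \<in> carrier R. \<exists>r \<in> carrier R. \<exists>s \<in> carrier R.
        a = r \<otimes>\<^bsub>R\<^esub> s \<and>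
        PIdl\<^bsub>R\<^esub> r <+>\<^bsub>R\<^esub> PIdl\<^bsub>R\<^esub> b = carrier R \<and>
        (\<forall>s' \<in> carrier R. s' divides\<^bsub>R\<^esub> s \<and> s' \<notin> Units R \<longrightarrow>
           PIdl\<^bsub>R\<^esub> s' <+>\<^bsub>R\<^esub> PIdl\<^bsub>R\<^esub> b \<noteq> carrier R))"

definition J_adequate_ring :: "('a, 'b) ring_scheme \<Rightarrow> bool" where
  "J_adequate_ring R \<longleftrightarrow> bezout_ring R \<and>
     (\<forall>a \<in> carrier R. a \<notin> jacobson_radical R \<longrightarrow> adequate R a)"

definition stable_range_one :: "('a, 'b) ring_scheme \<Rightarrow> bool" where
  "stable_range_one R \<longleftrightarrow> cring R \<and>
     (\<forall>a \<in> carrier R. \<forall>b \<in> carrier R.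
        PIdl\<^bsub>R\<^esub> a <+>\<^bsub>R\<^esub> PIdl\<^bsub>R\<^esub> b = carrier R \<longrightarrow>
        (\<exists>y \<in> carrier R. a \<oplus>\<^bsub>R\<^esub> b \<otimes>\<^bsub>R\<^esub> y \<in> Units R))"

definition J_stable :: "('a, 'b) ring_scheme \<Rightarrow> bool" where
  "J_stable R \<longleftrightarrow> cring R \<and>
     (\<forall>a \<in> carrier R. a \<notin> jacobson_radical R \<longrightarrow>
        stable_range_one (R Quot (PIdl\<^bsub>R\<^esub> a)))"

end

theory Submission
  imports Defs
begin

text \<open>
  The proof is local to one element: in a Bezout ring \<^term>\<open>R\<close>, the quotient by an adequate
  element \<open>a\<close> has stable range one (\<open>stable_range_one_quotient_adequate\<close>); J-adequacy supplies
  this for every \<open>a\<close> outside the Jacobson radical.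

  Unimodularity of \<open>(b, c)\<close> modulo \<open>a\<close> means that \<open>a\<close>, \<open>b\<close>, \<open>c\<close> together generate the unit ideal,
  and a unit \<open>b + c y\<close> of \<open>R/aR\<close> is an element of \<open>R\<close> comaximal with \<open>a\<close>. Write \<open>a = r s\<close> as in
  the definition of adequacy relative to \<open>b\<close>. The choice \<open>y = r\<close> works. Indeed \<open>b + c r\<close> is
  comaximal with \<open>r\<close> because \<open>b\<close> is. By the Bezout property, \<open>b + c r\<close> and \<open>s\<close> have a greatest
  common divisor \<open>d\<close>. An ideal containing \<open>d\<close> and \<open>b\<close> contains \<open>c r\<close>, hence \<open>c\<close> since \<open>r\<close> and
  \<open>b\<close> are comaximal, and it contains \<open>a = r s\<close>; so it is the whole ring. Thus \<open>d\<close> is a divisor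
  of \<open>s\<close> comaximal with \<open>b\<close>, and by the choice of \<open>s\<close> it is invertible. So \<open>b + c r\<close> is comaximal
  with \<open>s\<close> as well, hence with \<open>r s = a\<close>.
\<close>

definition comaximal :: "('a, 'b) ring_scheme \<Rightarrow> 'a \<Rightarrow> 'a \<Rightarrow> bool" where
  "comaximal R x y \<longleftrightarrow> PIdl\<^bsub>R\<^esub> x <+>\<^bsub>R\<^esub> PIdl\<^bsub>R\<^esub> y = carrier R"

context cring
begin

lemma ideal_minus_closed:
  assumes "ideal K R" "x \<in> K" "y \<in> K"
  shows "x \<ominus> y \<in> K"
proof -
  interpret K: ideal K R by fact
  show ?thesis using assms by (simp add: a_minus_def)
qed

lemma comaximal_iff_bezout:
  assumes x: "x \<in> carrier R" and y: "y \<in> carrier R"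
  shows "comaximal R x y \<longleftrightarrow>
    (\<exists>u \<in> carrier R. \<exists>v \<in> carrier R. u \<otimes> x \<oplus> v \<otimes> y = \<one>)"
proof -
  have I: "ideal (PIdl x <+> PIdl y) R"
    using cgenideal_ideal[OF x] cgenideal_ideal[OF y] by (rule add_ideals)
  have "comaximal R x y \<longleftrightarrow> \<one> \<in> PIdl x <+> PIdl y"
    unfolding comaximal_def using ideal.one_imp_carrier[OF I] by auto
  also have "\<dots> \<longleftrightarrow> (\<exists>u \<in> carrier R. \<exists>v \<in> carrier R. u \<otimes> x \<oplus> v \<otimes> y = \<one>)"
    unfolding set_add_def' cgenideal_def by force
  finally show ?thesis .
qed

text \<open>
  Quantifying over the ideals through \<open>x\<close> and \<open>y\<close> turns comaximality arguments into mere
  membership checks, with no Bezout coefficients to carry along.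
\<close>
lemma comaximal_iff_ideals:
  assumes x: "x \<in> carrier R" and y: "y \<in> carrier R"
  shows "comaximal R x y \<longleftrightarrow> (\<forall>K. ideal K R \<and> x \<in> K \<and> y \<in> K \<longrightarrow> \<one> \<in> K)"
proof
  assume "comaximal R x y"
  then obtain u v where uv: "u \<in> carrier R" "v \<in> carrier R" "u \<otimes> x \<oplus> v \<otimes> y = \<one>"
    using comaximal_iff_bezout[OF x y] by blast
  show "\<forall>K. ideal K R \<and> x \<in> K \<and> y \<in> K \<longrightarrow> \<one> \<in> K"
  proof (intro allI impI; elim conjE)
    fix K assume K: "ideal K R" "x \<in> K" "y \<in> K"
    interpret K: ideal K R by fact
    have "u \<otimes> x \<oplus> v \<otimes> y \<in> K"
      by (intro K.a_closed K.I_l_closed K uv)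
    then show "\<one> \<in> K" using uv by simp
  qed
next
  assume *: "\<forall>K. ideal K R \<and> x \<in> K \<and> y \<in> K \<longrightarrow> \<one> \<in> K"
  have I: "ideal (PIdl x <+> PIdl y) R"
    using cgenideal_ideal[OF x] cgenideal_ideal[OF y] by (rule add_ideals)
  have "x = \<one> \<otimes> x \<oplus> \<zero> \<otimes> y" "y = \<zero> \<otimes> x \<oplus> \<one> \<otimes> y"
    using x y by simp_all
  then have "x \<in> PIdl x <+> PIdl y" "y \<in> PIdl x <+> PIdl y"
    unfolding set_add_def' cgenideal_def by blast+
  with * I have "\<one> \<in> PIdl x <+> PIdl y" by blast
  then show "comaximal R x y"
    unfolding comaximal_def by (rule ideal.one_imp_carrier[OF I])
qed

text \<open>
  Modulo \<open>K\<close>, the element \<open>c\<close> is killed by both \<open>x\<close> and \<open>y\<close>, hence by \<open>\<one>\<close>.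
\<close>
lemma comaximal_cancel:
  assumes "comaximal R x y" and car: "x \<in> carrier R" "y \<in> carrier R" "c \<in> carrier R"
    and K: "ideal K R" "c \<otimes> x \<in> K" "c \<otimes> y \<in> K"
  shows "c \<in> K"
proof -
  interpret K: ideal K R by fact
  obtain u v where uv: "u \<in> carrier R" "v \<in> carrier R" "u \<otimes> x \<oplus> v \<otimes> y = \<one>"
    using assms(1) comaximal_iff_bezout[OF car(1,2)] by blast
  have "u \<otimes> (c \<otimes> x) \<oplus> v \<otimes> (c \<otimes> y) \<in> K"
    by (intro K.a_closed K.I_l_closed K uv)
  moreover have "u \<otimes> (c \<otimes> x) \<oplus> v \<otimes> (c \<otimes> y) = c \<otimes> (u \<otimes> x \<oplus> v \<otimes> y)"
    using uv(1,2) car by (simp add: r_distr m_lcomm)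
  ultimately show ?thesis using uv(3) car by simp
qed

lemma comaximal_mult_right:
  assumes "comaximal R x r" "comaximal R x s"
    and car: "x \<in> carrier R" "r \<in> carrier R" "s \<in> carrier R"
  shows "comaximal R x (r \<otimes> s)"
proof -
  have "\<one> \<in> K" if K: "ideal K R" "x \<in> K" "r \<otimes> s \<in> K" for K
  proof -
    interpret K: ideal K R by fact
    have "s \<otimes> x \<in> K" using K car by (intro K.I_l_closed)
    moreover have "s \<otimes> r \<in> K" using K car by (simp add: m_comm)
    ultimately have "s \<in> K" using comaximal_cancel[OF assms(1) car] K(1) by blast
    with assms(2) K car show ?thesis by (simp add: comaximal_iff_ideals)
  qed
  with car show ?thesis by (simp add: comaximal_iff_ideals)
qed

text \<open>
  This is where adequacy is used: the first factor \<open>r\<close> of \<open>a\<close>, taken relative to \<open>b\<close>, serves as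
  the multiplier that witnesses stable range one modulo \<open>a\<close>.
\<close>
lemma adequate_comaximal_shift:
  assumes bez: "bezout_ring R" and "adequate R a"
    and bc: "b \<in> carrier R" "c \<in> carrier R"
    and abc: "\<And>K. \<lbrakk>ideal K R; a \<in> K; b \<in> K; c \<in> K\<rbrakk> \<Longrightarrow> \<one> \<in> K"
  shows "\<exists>y \<in> carrier R. comaximal R (b \<oplus> c \<otimes> y) a"
proof -
  obtain r s where rs: "r \<in> carrier R" "s \<in> carrier R" "a = r \<otimes> s"
    and rb: "comaximal R r b"
    and s: "\<And>s'. \<lbrakk>s' \<in> carrier R; s' divides s; s' \<notin> Units R\<rbrakk> \<Longrightarrow> \<not> comaximal R s' b"
    using assms(2) bc(1) unfolding adequate_def comaximal_def by metis
  let ?x = "b \<oplus> c \<otimes> r"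
  have x: "?x \<in> carrier R" using bc rs by simp
  have b_mem: "b \<in> K" if K: "ideal K R" "?x \<in> K" "r \<in> K" for K
  proof -
    interpret K: ideal K R by fact
    have "?x \<ominus> c \<otimes> r \<in> K" using K bc by (intro ideal_minus_closed K.I_l_closed)
    moreover have "?x \<ominus> c \<otimes> r = b" using bc rs by algebra
    ultimately show ?thesis by simp
  qed
  have xr: "comaximal R ?x r"
    using rb b_mem x rs bc by (auto simp: comaximal_iff_ideals)
  have "principalideal (Idl {?x, s}) R"
    using bez x rs unfolding bezout_ring_def by auto
  then obtain d where d: "d \<in> carrier R" "Idl {?x, s} = PIdl d"
    using principalideal.generate cgenideal_eq_genideal by metis
  have xs_mem: "?x \<in> PIdl d" "s \<in> PIdl d"
    using genideal_self[of "{?x, s}"] x rs d by auto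
  have mem_of_d: "?x \<in> K \<and> s \<in> K" if "ideal K R" "d \<in> K" for K
    using xs_mem cgenideal_minimal[OF that] by blast
  have "d divides s"
    using xs_mem(2) d(1) m_comm unfolding cgenideal_def factor_def by auto
  moreover have "comaximal R d b"
  proof -
    have "\<one> \<in> K" if K: "ideal K R" "d \<in> K" "b \<in> K" for K
    proof -
      interpret K: ideal K R by fact
      have xs: "?x \<in> K" "s \<in> K" using mem_of_d K by auto
      have "?x \<ominus> b \<in> K" using xs K by (intro ideal_minus_closed)
      moreover have "?x \<ominus> b = c \<otimes> r" using bc rs by algebra
      ultimately have "c \<otimes> r \<in> K" by simp
      moreover have "c \<otimes> b \<in> K" using K bc by (intro K.I_l_closed)
      ultimately have "c \<in> K" using comaximal_cancel[OF rb rs(1) bc] K(1) by blast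
      moreover have "a \<in> K" using xs rs by (simp add: K.I_l_closed)
      ultimately show ?thesis using abc K by blast
    qed
    with d(1) bc show ?thesis by (simp add: comaximal_iff_ideals)
  qed
  ultimately have "d \<in> Units R" using s d(1) by blast
  then have "\<one> \<in> PIdl d"
    unfolding cgenideal_def Units_def by force
  moreover have "PIdl d \<subseteq> K" if "ideal K R" "?x \<in> K" "s \<in> K" for K
    using genideal_minimal[OF that(1), of "{?x, s}"] that d(2) by simp
  ultimately have "comaximal R ?x s"
    using x rs by (auto simp: comaximal_iff_ideals)
  with xr have "comaximal R ?x a"
    using comaximal_mult_right x rs by simp
  with rs show ?thesis by blast
qed

theorem stable_range_one_quotient_adequate:
  assumes bez: "bezout_ring R" and ad: "adequate R a"
  shows "stable_range_one (R Quot (PIdl a))"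
proof -
  have a: "a \<in> carrier R" using ad by (simp add: adequate_def)
  let ?I = "PIdl a"
  let ?Q = "R Quot ?I"
  interpret I: ideal ?I R by (rule cgenideal_ideal[OF a])
  interpret Q: cring ?Q by (rule I.quotient_is_cring[OF is_cring])
  interpret h: ring_hom_ring R ?Q "(+>) ?I" by (rule I.rcos_ring_hom_ring)
  have lift: "\<exists>x \<in> carrier R. X = ?I +> x" if "X \<in> carrier ?Q" for X
    using that unfolding FactRing_def A_RCOSETS_def' by simp
  have "\<exists>Y \<in> carrier ?Q. B \<oplus>\<^bsub>?Q\<^esub> C \<otimes>\<^bsub>?Q\<^esub> Y \<in> Units ?Q"
    if B: "B \<in> carrier ?Q" and C: "C \<in> carrier ?Q"
      and BC: "PIdl\<^bsub>?Q\<^esub> B <+>\<^bsub>?Q\<^esub> PIdl\<^bsub>?Q\<^esub> C = carrier ?Q" for B C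
  proof -
    obtain b c where bc: "b \<in> carrier R" "c \<in> carrier R" "B = ?I +> b" "C = ?I +> c"
      using lift B C by metis
    obtain U V where UV: "U \<in> carrier ?Q" "V \<in> carrier ?Q"
      and UV1: "U \<otimes>\<^bsub>?Q\<^esub> B \<oplus>\<^bsub>?Q\<^esub> V \<otimes>\<^bsub>?Q\<^esub> C = \<one>\<^bsub>?Q\<^esub>"
      using BC Q.comaximal_iff_bezout[OF B C] unfolding comaximal_def by blast
    obtain u v where uv: "u \<in> carrier R" "v \<in> carrier R" "U = ?I +> u" "V = ?I +> v"
      using lift UV by metis
    let ?t = "u \<otimes> b \<oplus> v \<otimes> c"
    have t: "?t \<in> carrier R" using uv bc by simp
    have "?I +> ?t = ?I +> \<one>" using UV1 uv bc by simp
    then have diff: "?t \<ominus> \<one> \<in> ?I"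
      using quotient_eq_iff_same_a_r_cos[OF I.is_ideal t one_closed] by simp
    have "\<one> \<in> K" if K: "ideal K R" "a \<in> K" "b \<in> K" "c \<in> K" for K
    proof -
      interpret K: ideal K R by fact
      have "?t \<in> K" using K uv by (intro K.a_closed K.I_l_closed)
      moreover have "?t \<ominus> \<one> \<in> K" using diff cgenideal_minimal[OF K(1,2)] by blast
      ultimately have "?t \<ominus> (?t \<ominus> \<one>) \<in> K" by (rule ideal_minus_closed[OF K(1)])
      moreover have "?t \<ominus> (?t \<ominus> \<one>) = \<one>" using uv bc by algebra
      ultimately show ?thesis by simp
    qed
    then obtain y where y: "y \<in> carrier R" "comaximal R (b \<oplus> c \<otimes> y) a"
      using adequate_comaximal_shift[OF bez ad bc(1,2)] by blast
    let ?x = "b \<oplus> c \<otimes> y"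
    have x: "?x \<in> carrier R" using bc y by simp
    obtain w z where wz: "w \<in> carrier R" "z \<in> carrier R" "w \<otimes> ?x \<oplus> z \<otimes> a = \<one>"
      using y(2) comaximal_iff_bezout[OF x a] by blast
    have "?I +> a = \<zero>\<^bsub>?Q\<^esub>"
      using I.a_rcos_const[OF cgenideal_self[OF a]] unfolding FactRing_def by simp
    then have "(?I +> w) \<otimes>\<^bsub>?Q\<^esub> (?I +> ?x) = ?I +> (w \<otimes> ?x \<oplus> z \<otimes> a)"
      using wz(1,2) x a bc y by simp
    also have "\<dots> = \<one>\<^bsub>?Q\<^esub>" using wz(3) by simp
    finally have wx: "(?I +> w) \<otimes>\<^bsub>?Q\<^esub> (?I +> ?x) = \<one>\<^bsub>?Q\<^esub>" .
    have "?I +> ?x \<in> Units ?Q"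
      using wx x wz(1) Q.m_comm[of "?I +> w" "?I +> ?x"] h.hom_closed
      unfolding Units_def by auto
    moreover have "?I +> ?x = B \<oplus>\<^bsub>?Q\<^esub> C \<otimes>\<^bsub>?Q\<^esub> (?I +> y)"
      using bc y by simp
    ultimately show ?thesis using y(1) h.hom_closed by metis
  qed
  then show ?thesis
    unfolding stable_range_one_def using Q.is_cring by blast
qed

end

theorem theorem3p2:
  fixes R :: "('a, 'b) ring_scheme"
  assumes "J_adequate_ring R"
  shows "J_stable R"
proof -
  have bez: "bezout_ring R" and ad: "\<And>a. \<lbrakk>a \<in> carrier R; a \<notin> jacobson_radical R\<rbrakk> \<Longrightarrow> adequate R a"
    using assms by (auto simp: J_adequate_ring_def)
  from bez have R: "cring R" by (simp add: bezout_ring_def)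
  with cring.stable_range_one_quotient_adequate[OF R bez] ad show ?thesis
    by (simp add: J_stable_def)
qed

end
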